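(* Let $\rho : [0,1] \to [0,+\infty)$ be a measurable (nonnegative) weight such that $\int_0^1 \rho(r)\, r\, dr < \infty$, and let $\Psi : \mathbb{R} \to \mathbb{R}$ be an even convex function. For an integer $n \ge 1$, for $a = (a_1,\dots,a_n) \in \mathbb{C}^n$ with $|a_k| = 1$ for $k=1,\dots,n$, and for $b = (b_1,\dots,b_{n-1}) \in \mathbb{C}^{n-1}$ (no restriction on the $b_k$), set $$\mathcal{I}_n(a,b) = \int_{|z|\le 1} \rho(|z|)\, \Psi\left(\left| \frac{\prod_{k=1}^{n-1}(z-b_k)}{\prod_{k=1}^{n}(z-a_k)} \right|\right) dA .$$ Then for every integer $n \ge 1$, $\mathcal{I}_n$ attains its minimum over all such pairs $(a,b)$ at $$a_k = \exp(2k\pi i/n),\quad k=1,\dots,n, \qquad b_j = 0,\quad j = 1,\dots,n-1 .$$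
   Context: $dA$ denotes area (two-dimensional Lebesgue) measure on $\mathbb{C}$. The numbers $a_k$ are not required to be distinct. The value $\mathcal{I}_n(a,b)$ may equal $+\infty$; the claim is that $\mathcal{I}_n(a,b) \ge \mathcal{I}_n(a^*,b^* )$ in $(-\infty,+\infty]$ for all admissible $(a,b)$, where $(a^*,b^* )$ is the stated configuration. Empty products equal $1$. *)

theory Defs
  imports "HOL-Analysis.Analysis"
begin

text \<open>
  The integral of a real function with values in the extended reals: positive part minus
  negative part (\<^const>\<open>ennreal\<close> sends negative numbers to 0). It is meaningful for measurable
  functions whose negative part has finite integral; on the type \<^typ>\<open>ereal\<close> the expression
  \<open>\<infinity> - \<infinity>\<close> is \<open>\<infinity>\<close>. In the use below, an even convex \<open>\<Psi>\<close> is bounded below by \<open>\<Psi> 0\<close>, so the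
  negative part is dominated by an integrable multiple of \<open>\<rho> (cmod z)\<close>.
\<close>
definition ext_integral :: "'a measure \<Rightarrow> ('a \<Rightarrow> real) \<Rightarrow> ereal" where
  "ext_integral M f =
     enn2ereal (\<integral>\<^sup>+ x. ennreal (f x) \<partial>M) - enn2ereal (\<integral>\<^sup>+ x. ennreal (- f x) \<partial>M)"

text \<open>
  Only \<open>a 1, \<dots>, a n\<close> and \<open>b 1, \<dots>, b (n - 1)\<close> are used. At the finitely many points \<open>z = a k\<close>
  the quotient takes the value 0 by totality of division; this is a null set.
\<close>
definition energy ::
  "(real \<Rightarrow> real) \<Rightarrow> (real \<Rightarrow> real) \<Rightarrow> nat \<Rightarrow> (nat \<Rightarrow> complex) \<Rightarrow> (nat \<Rightarrow> complex) \<Rightarrow> ereal" where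
  "energy \<rho> \<Psi> n a b =
     ext_integral (lebesgue_on (cball 0 1))
       (\<lambda>z::complex. \<rho> (cmod z) *
          \<Psi> (cmod ((\<Prod>k=1..n-1. z - b k) / (\<Prod>k=1..n. z - a k))))"

definition admissible :: "nat \<Rightarrow> (nat \<Rightarrow> complex) \<Rightarrow> bool" where
  "admissible n a \<longleftrightarrow> (\<forall>k\<in>{1..n}. cmod (a k) = 1)"

definition roots_config :: "nat \<Rightarrow> nat \<Rightarrow> complex" where
  "roots_config n k = exp (2 * of_nat k * of_real pi * \<i> / of_nat n)"

end

theory Submission
  imports Defs "HOL-Complex_Analysis.Complex_Analysis"
begin

text \<open>
  By rotation invariance of area it suffices to compare, for each \<open>z\<close> with \<open>0 < |z| < 1\<close>, the means
  of \<open>\<Psi> |Q/P|\<close> over the circle through \<open>z\<close>, where \<open>Q/P\<close> is the quotient with zeros \<open>b\<^sub>k\<close> and poles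
  \<open>a\<^sub>k\<close>. On \<open>|w| = 1\<close> one has \<open>|Q/P (z w)| = |K w|\<close> with \<open>K\<close> the holomorphic function obtained by
  reflecting \<open>Q\<close>. Let \<open>E\<close> be the Blaschke product with zeros \<open>cnj z * a\<^sub>k\<close>. Then the means of
  \<open>K * cnj E ^ m\<close> vanish for \<open>m > 0\<close>, and those of \<open>K * E ^ m\<close> are determined by
  \<open>K 0 = cnj z ^ (n - 1)\<close> and \<open>E 0 = cnj z ^ n\<close>. Hence the mean of \<open>K * H E\<close> does not depend on
  \<open>(a, b)\<close>, for every continuous \<open>H\<close>. For the roots of unity and \<open>b = 0\<close>, \<open>K = k E\<close> for an
  explicit function \<open>k\<close>, and the claim follows from the subgradient inequality
  \<open>\<Psi> |K| \<ge> \<Psi> |k E| + \<sigma> |k E| * (Re (K * cnj (sgn (k E))) - |k E|)\<close>, whose right hand side has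
  a mean independent of \<open>(a, b)\<close>, with equality at the symmetric configuration.
\<close>

subsection \<open>Integrals over the unit circle\<close>

definition circ :: "real \<Rightarrow> complex" where
  "circ t = cis (2 * pi * t)"

lemma norm_circ [simp]: "cmod (circ t) = 1"
  by (simp add: circ_def)

lemma circ_nonzero [simp]: "circ t \<noteq> 0"
  by (simp add: circ_def)

lemma continuous_on_circ [continuous_intros]: "continuous_on S circ"
  unfolding circ_def cis_conv_exp by (intro continuous_intros)

text \<open>Cauchy's formula at the centre: the velocity of the circle path cancels the kernel
  \<open>1 / u\<close>, leaving the plain mean over a parameter interval of length 1.\<close>

lemma mean_value_circ:
  assumes "F holomorphic_on cball 0 1"
  shows "((\<lambda>t. F (circ t)) has_integral F 0) {0..1}"
proof -
  have c: "circlepath 0 1 t = circ t" for t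
    by (simp add: circlepath circ_def cis_conv_exp mult_ac)
  have "((\<lambda>u. F u / (u - 0)) has_contour_integral (2 * of_real pi * \<i> * F 0)) (circlepath 0 1)"
    by (rule Cauchy_integral_circlepath_simple[OF assms]) simp
  then have "((\<lambda>t. F (circ t) / circ t * (2 * of_real pi * \<i> * circ t)) has_integral
      (2 * of_real pi * \<i> * F 0)) {0..1}"
    unfolding has_contour_integral
    by (simp add: c vector_derivative_circlepath)
       (simp add: circ_def cis_conv_exp mult_ac)
  from has_integral_mult_right[OF this, of "1 / (2 * of_real pi * \<i>)"]
  show ?thesis by simp
qed

text \<open>The difference \<open>J\<close> of the two integrals is linear in the test function and
  bounded by its sup norm on the circle. The moment hypotheses make it vanish on powers of
  \<open>s\<close> and \<open>cnj s\<close>, hence on polynomials in \<open>Re s\<close> and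
  \<open>Im s\<close>, and Stone-Weierstrass carries this over to \<open>H\<close>.\<close>

lemma trig_moments_determine:
  fixes g1 g2 e1 e2 H :: "_ \<Rightarrow> complex"
  assumes g: "continuous_on {0..1::real} g1" "continuous_on {0..1::real} g2"
    and e: "continuous_on {0..1} e1" "continuous_on {0..1} e2"
    and e1: "\<And>t. t \<in> {0..1} \<Longrightarrow> cmod (e1 t) = 1"
    and e2: "\<And>t. t \<in> {0..1} \<Longrightarrow> cmod (e2 t) = 1"
    and pos: "\<And>m. integral {0..1} (\<lambda>t. g1 t * e1 t ^ m) = integral {0..1} (\<lambda>t. g2 t * e2 t ^ m)"
    and neg: "\<And>m. integral {0..1} (\<lambda>t. g1 t * cnj (e1 t) ^ m) =
                 integral {0..1} (\<lambda>t. g2 t * cnj (e2 t) ^ m)"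
    and H: "continuous_on (sphere 0 1) H"
  shows "integral {0..1} (\<lambda>t. g1 t * H (e1 t)) = integral {0..1} (\<lambda>t. g2 t * H (e2 t))"
proof -
  define J where "J k = integral {0..1} (\<lambda>t. g1 t * k (e1 t)) - integral {0..1} (\<lambda>t. g2 t * k (e2 t))"
    for k :: "complex \<Rightarrow> complex"
  define C where "C = {k :: complex \<Rightarrow> complex. continuous_on (sphere 0 1) k}"
  have sph: "e1 ` {0..1} \<subseteq> sphere 0 1" "e2 ` {0..1} \<subseteq> sphere 0 1"
    using e1 e2 by auto
  have cont: "continuous_on {0..1} (\<lambda>t. g1 t * k (e1 t))" "continuous_on {0..1} (\<lambda>t. g2 t * k (e2 t))"
    if "k \<in> C" for k
    using that sph g e unfolding C_def
    by (auto intro!: continuous_on_mult intro: continuous_on_compose2)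
  have int: "(\<lambda>t. g1 t * k (e1 t)) integrable_on {0..1}" "(\<lambda>t. g2 t * k (e2 t)) integrable_on {0..1}"
    if "k \<in> C" for k
    using cont[OF that] by (auto intro: integrable_continuous_real)
  have J_add: "J (\<lambda>s. k s + l s) = J k + J l" if "k \<in> C" "l \<in> C" for k l
    using int[OF that(1)] int[OF that(2)]
    by (simp add: J_def distrib_left integral_add)
  have J_mult: "J (\<lambda>s. c * k s) = c * J k" for c k
    by (simp add: J_def mult.left_commute[of _ c] right_diff_distrib)
  have C_add: "(\<lambda>s. k s + l s) \<in> C" if "k \<in> C" "l \<in> C" for k l
    using that by (auto simp: C_def intro!: continuous_intros)
  have C_mult: "(\<lambda>s. k s * l s) \<in> C" if "k \<in> C" "l \<in> C" for k l
    using that by (auto simp: C_def intro!: continuous_intros)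
  have C_const: "(\<lambda>s. c) \<in> C" for c
    by (auto simp: C_def)
  have C_mono: "(\<lambda>s. s ^ i * cnj s ^ j * k s) \<in> C" if "k \<in> C" for i j k
    using that by (auto simp: C_def intro!: continuous_intros)
  have J_cong: "J k = J l" if "\<And>s. cmod s = 1 \<Longrightarrow> k s = l s" for k l
    unfolding J_def using that e1 e2 by (auto intro!: arg_cong2[of _ _ _ _ "(-)"] integral_cong)

  text \<open>Multiplication by \<open>s\<close> and by \<open>cnj s\<close> preserves \<open>V\<close>, hence so does every polynomial.\<close>
  define V where "V = {k \<in> C. \<forall>i j. J (\<lambda>s. s ^ i * cnj s ^ j * k s) = 0}"
  have V_one: "(\<lambda>_. 1) \<in> V"
  proof -
    \<comment> \<open>On the circle \<open>s * cnj s = 1\<close>, so a mixed monomial collapses to a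
      pure power of \<open>s\<close> or of \<open>cnj s\<close>, the cases covered by
      \<open>pos\<close> and \<open>neg\<close>.\<close>
    have "J (\<lambda>s. s ^ i * cnj s ^ j * 1) = 0" for i j
    proof (cases "j \<le> i")
      case True
      have "J (\<lambda>s. s ^ i * cnj s ^ j * 1) = J (\<lambda>s. s ^ (i - j))"
      proof (rule J_cong)
        fix s :: complex assume s: "cmod s = 1"
        have "s ^ i * cnj s ^ j = s ^ (i - j) * (s * cnj s) ^ j"
          using True by (simp add: power_mult_distrib flip: power_add mult.assoc)
        then show "s ^ i * cnj s ^ j * 1 = s ^ (i - j)"
          using s by (simp add: complex_norm_square[symmetric])
      qed
      then show ?thesis using pos by (simp add: J_def)
    next
      case False
      have "J (\<lambda>s. s ^ i * cnj s ^ j * 1) = J (\<lambda>s. cnj s ^ (j - i))"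
      proof (rule J_cong)
        fix s :: complex assume s: "cmod s = 1"
        have "s ^ i * cnj s ^ j = (s * cnj s) ^ i * cnj s ^ (j - i)"
          using False by (simp add: power_mult_distrib mult.assoc flip: power_add)
        then show "s ^ i * cnj s ^ j * 1 = cnj s ^ (j - i)"
          using s by (simp add: complex_norm_square[symmetric])
      qed
      then show ?thesis using neg by (simp add: J_def)
    qed
    then show ?thesis by (auto simp: V_def C_const)
  qed
  have V_add: "(\<lambda>s. k s + l s) \<in> V" if "k \<in> V" "l \<in> V" for k l
    using that by (auto simp: V_def C_add distrib_left J_add C_mono)
  have V_scale: "(\<lambda>s. c * k s) \<in> V" if "k \<in> V" for k c
    using that by (auto simp: V_def C_mult C_const mult.left_commute[of _ c] J_mult)
  have V_id: "(\<lambda>s. s * k s) \<in> V" if "k \<in> V" for k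
  proof -
    have "J (\<lambda>s. s ^ i * cnj s ^ j * (s * k s)) = 0" for i j
    proof -
      have "J (\<lambda>s. s ^ Suc i * cnj s ^ j * k s) = 0"
        using that unfolding V_def by blast
      then show ?thesis by (simp add: mult_ac)
    qed
    moreover have "(\<lambda>s. s * k s) \<in> C"
      using that by (auto simp: C_def V_def intro!: continuous_intros)
    ultimately show ?thesis by (simp add: V_def)
  qed
  have V_cnj: "(\<lambda>s. cnj s * k s) \<in> V" if "k \<in> V" for k
  proof -
    have "J (\<lambda>s. s ^ i * cnj s ^ j * (cnj s * k s)) = 0" for i j
    proof -
      have "J (\<lambda>s. s ^ i * cnj s ^ Suc j * k s) = 0"
        using that unfolding V_def by blast
      then show ?thesis by (simp add: mult_ac)
    qed
    moreover have "(\<lambda>s. cnj s * k s) \<in> C"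
      using that by (auto simp: C_def V_def intro!: continuous_intros)
    ultimately show ?thesis by (simp add: V_def)
  qed
  have V_poly: "(\<lambda>s. complex_of_real (p s) * k s) \<in> V"
    if "real_polynomial_function p" "k \<in> V" for p k
    using that
  proof (induction arbitrary: k)
    case (linear f)
    note k = linear(2)
    interpret bounded_linear f by fact
    \<comment> \<open>A real-linear functional on the plane is a complex combination of
      \<open>s\<close> and \<open>cnj s\<close>; these are its coefficients.\<close>
    define \<alpha> \<beta> where "\<alpha> = (f 1 - \<i> * f \<i>) / 2" and "\<beta> = (f 1 + \<i> * f \<i>) / 2"
    have f: "complex_of_real (f s) = \<alpha> * s + \<beta> * cnj s" for s
    proof -
      have "s = Re s *\<^sub>R 1 + Im s *\<^sub>R \<i>"
        by (simp add: complex_eq_iff)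
      then have "f s = Re s * f 1 + Im s * f \<i>"
        by (metis add scaleR real_scaleR_def)
      then show ?thesis
        by (simp add: complex_eq_iff field_simps \<alpha>_def \<beta>_def)
    qed
    have "(\<lambda>s. \<alpha> * (s * k s) + \<beta> * (cnj s * k s)) \<in> V"
      by (rule V_add[OF V_scale[OF V_id[OF k]] V_scale[OF V_cnj[OF k]]])
    then show ?case
      by (simp add: f distrib_right mult.assoc)
  next
    case (const c)
    then show ?case by (rule V_scale)
  next
    case (add f g)
    then show ?case using V_add by (simp add: distrib_right)
  next
    case (mult f g)
    then have "(\<lambda>s. f s * (g s * k s)) \<in> V" by auto
    then show ?case by (simp add: mult.assoc)
  qed
  have J_poly: "J g = 0 \<and> g \<in> C" if "polynomial_function g" for g
  proof -
    have "real_polynomial_function (Re \<circ> g)" "real_polynomial_function (Im \<circ> g)"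
      using that bounded_linear_Re bounded_linear_Im by (auto simp: polynomial_function_def)
    from V_poly[OF this(1) V_one] V_poly[OF this(2) V_one]
    have "(\<lambda>s. complex_of_real ((Re \<circ> g) s) * 1) \<in> V"
        "(\<lambda>s. \<i> * (complex_of_real ((Im \<circ> g) s) * 1)) \<in> V"
      using V_scale by blast+
    from V_add[OF this] have "(\<lambda>s. Re (g s) + \<i> * Im (g s)) \<in> V"
      by simp
    then have "g \<in> V"
      by (simp flip: complex_eq)
    then have "J (\<lambda>s. s ^ 0 * cnj s ^ 0 * g s) = 0" "g \<in> C"
      unfolding V_def by blast+
    then show ?thesis by simp
  qed
  have "\<exists>M. \<forall>t\<in>{0..1::real}. cmod (h t) \<le> M" if "continuous_on {0..1} h" for h
    using compact_imp_bounded[OF compact_continuous_image[OF that]] by (auto simp: bounded_iff)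
  then obtain M1 M2 where M1: "\<And>t. t \<in> {0..1} \<Longrightarrow> cmod (g1 t) \<le> M1"
    and M2: "\<And>t. t \<in> {0..1} \<Longrightarrow> cmod (g2 t) \<le> M2"
    using g by metis
  have M0: "0 \<le> M1" "0 \<le> M2"
    using order_trans[OF norm_ge_zero M1[of 0]] order_trans[OF norm_ge_zero M2[of 0]] by auto
  have HC: "H \<in> C" using H by (simp add: C_def)
  have small: "cmod (J H) \<le> d * (M1 + M2)" if d: "d > 0" for d
  proof -
    obtain g where g: "polynomial_function g" "\<And>s. s \<in> sphere 0 1 \<Longrightarrow> cmod (H s - g s) < d"
      using Stone_Weierstrass_polynomial_function[OF compact_sphere H d] by blast
    have gC: "g \<in> C" and Jg: "J g = 0" using J_poly[OF g(1)] by auto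
    define h where "h s = H s + (-1) * g s" for s
    have hC: "h \<in> C" unfolding h_def by (intro C_add C_mult HC gC C_const)
    have "J h = J H + J (\<lambda>s. (-1) * g s)"
      unfolding h_def by (rule J_add) (intro C_mult HC gC C_const)+
    then have "J h = J H" using Jg J_mult[of "-1" g] by simp
    have hd: "cmod (h s) \<le> d" if "cmod s = 1" for s
      using g(2)[of s] that by (simp add: h_def)
    have "cmod (integral {0..1} (\<lambda>t. g1 t * h (e1 t))) \<le> (M1 * d) * (1 - 0)"
      using M1 hd e1 M0 d cont[OF hC]
      by (intro integral_bound) (auto simp: norm_mult intro!: mult_mono)
    moreover have "cmod (integral {0..1} (\<lambda>t. g2 t * h (e2 t))) \<le> (M2 * d) * (1 - 0)"
      using M2 hd e2 M0 d cont[OF hC]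
      by (intro integral_bound) (auto simp: norm_mult intro!: mult_mono)
    ultimately have "cmod (J h) \<le> M1 * d + M2 * d"
      unfolding J_def by (smt (verit) norm_triangle_ineq4 mult_cancel_left1)
    then show ?thesis using \<open>J h = J H\<close> by (simp add: algebra_simps)
  qed
  have "J H = 0"
  proof (rule ccontr)
    assume "J H \<noteq> 0"
    \<comment> \<open>The summand 1 keeps the denominator positive; the factor 2 turns
      \<open>small\<close> into the absurd bound of \<open>cmod (J H)\<close> by its own
      half.\<close>
    define d where "d = cmod (J H) / (2 * (M1 + M2 + 1))"
    have "d > 0" using \<open>J H \<noteq> 0\<close> M0 by (auto simp: d_def)
    have "d * (M1 + M2) \<le> d * (M1 + M2 + 1)" using \<open>d > 0\<close> by simp
    also have "\<dots> = cmod (J H) / 2" using M0 by (simp add: d_def divide_simps)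
    finally have "cmod (J H) \<le> cmod (J H) / 2" using small[OF \<open>d > 0\<close>] by linarith
    moreover have "cmod (J H) > 0" using \<open>J H \<noteq> 0\<close> by simp
    ultimately show False by linarith
  qed
  then show ?thesis by (simp add: J_def)
qed

subsection \<open>The reflected quotient and its Blaschke product\<close>

definition quot :: "nat \<Rightarrow> (nat \<Rightarrow> complex) \<Rightarrow> (nat \<Rightarrow> complex) \<Rightarrow> complex \<Rightarrow> complex" where
  "quot n a b z = (\<Prod>k=1..n-1. z - b k) / (\<Prod>k=1..n. z - a k)"

text \<open>Each factor is the Blaschke factor with zero \<open>cnj z * a k\<close> up to a
  unimodular constant: \<open>z * w - a k = - a k * (1 - z * cnj (a k) * w)\<close>. This
  normalisation makes the value at 0 independent of \<open>a\<close>.\<close>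

definition blaschke :: "nat \<Rightarrow> (nat \<Rightarrow> complex) \<Rightarrow> complex \<Rightarrow> complex \<Rightarrow> complex" where
  "blaschke n a z w = (\<Prod>k=1..n. w - cnj z * a k) / (\<Prod>k=1..n. z * w - a k)"

text \<open>For \<open>cmod w = 1\<close>, \<open>cnj z - cnj (b k) * w\<close> is
  \<open>w * cnj (z * w - b k)\<close>, and the factors below have the moduli of
  \<open>z * w - a k\<close>. So the modulus of the quotient is kept on the circle, while the value
  at 0 becomes independent of \<open>a\<close> and \<open>b\<close>.\<close>

definition dual_quot ::
  "nat \<Rightarrow> (nat \<Rightarrow> complex) \<Rightarrow> (nat \<Rightarrow> complex) \<Rightarrow> complex \<Rightarrow> complex \<Rightarrow> complex" where
  "dual_quot n a b z w =
     (\<Prod>k=1..n-1. cnj z - cnj (b k) * w) / (\<Prod>k=1..n. 1 - z * cnj (a k) * w)"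

lemma norm_mult_less_1:
  fixes z w :: complex
  assumes "cmod z < 1" "cmod w \<le> 1"
  shows "cmod (z * w) < 1"
  using mult_right_le_one_le[of "cmod z" "cmod w"] assms by (simp add: norm_mult)

lemma denominators_nonzero:
  fixes z w a :: complex
  assumes "cmod z < 1" "cmod w \<le> 1" "cmod a = 1"
  shows "z * w - a \<noteq> 0" "1 - z * cnj a * w \<noteq> 0" 
proof -
  show "z * w - a \<noteq> 0"
    using norm_mult_less_1[OF assms(1,2)] assms(3) by auto
  have "cmod (z * cnj a * w) < 1"
    using norm_mult_less_1[OF assms(1,2)] assms(3) by (simp add: norm_mult)
  then show "1 - z * cnj a * w \<noteq> 0" by auto
qed

lemma holomorphic_blaschke:
  assumes "admissible n a" "cmod z < 1"
  shows "blaschke n a z holomorphic_on cball 0 1"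
  unfolding blaschke_def using assms denominators_nonzero(1)[OF assms(2)]
  by (intro holomorphic_intros) (auto simp: admissible_def)

lemma holomorphic_dual_quot:
  assumes "admissible n a" "cmod z < 1"
  shows "dual_quot n a b z holomorphic_on cball 0 1"
  unfolding dual_quot_def using assms denominators_nonzero(2)[OF assms(2)]
  by (intro holomorphic_intros) (auto simp: admissible_def)

lemma holomorphic_quot:
  assumes "admissible n a" "cmod z < 1"
  shows "(\<lambda>w. quot n a b (z * w)) holomorphic_on cball 0 1"
  unfolding quot_def using assms denominators_nonzero(1)[OF assms(2)]
  by (intro holomorphic_intros) (auto simp: admissible_def)

lemma cnj_unimodular:
  assumes "cmod w = 1"
  shows "cnj w = 1 / w" "w \<noteq> 0"
  using assms by (auto simp: divide_conv_cnj)

text \<open>The first identity makes Blaschke factors unimodular on the circle; the second exhibits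
  the numerator of \<open>blaschke\<close> as the reflected denominator of
  \<open>dual_quot\<close>.\<close>

lemma blaschke_factor_reflection:
  assumes "cmod w = 1" "cmod a = 1"
  shows "w - cnj z * a = - (cnj (z * w - a) * w * a)" "w * cnj (1 - z * cnj a * w) = w - cnj z * a"
proof -
  have "w * cnj w = 1" "a * cnj a = 1"
    using assms by (simp_all add: complex_norm_square[symmetric])
  then show "w - cnj z * a = - (cnj (z * w - a) * w * a)" "w * cnj (1 - z * cnj a * w) = w - cnj z * a"
    unfolding complex_cnj_diff complex_cnj_mult complex_cnj_cnj complex_cnj_one by algebra+
qed

lemma norm_blaschke:
  assumes "admissible n a" "cmod z < 1" "cmod w = 1"
  shows "cmod (blaschke n a z w) = 1"
proof -
  have "cmod (w - cnj z * a k) = cmod (z * w - a k)" if "k \<in> {1..n}" for k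
  proof -
    have "cmod (a k) = 1" using assms that by (auto simp: admissible_def)
    then show ?thesis using assms(3)
      by (subst blaschke_factor_reflection) (auto simp del: complex_cnj_diff simp: norm_mult)
  qed
  then have "(\<Prod>k=1..n. cmod (w - cnj z * a k)) = (\<Prod>k=1..n. cmod (z * w - a k))"
    by (rule prod.cong[OF refl])
  moreover have "(\<Prod>k=1..n. z * w - a k) \<noteq> 0"
    using denominators_nonzero(1)[OF assms(2)] assms(1,3) by (auto simp: admissible_def)
  ultimately show ?thesis
    by (simp add: blaschke_def norm_divide flip: prod_norm)
qed

text \<open>Reflection costs \<open>w ^ n\<close> in the denominator but only
  \<open>w ^ (n - 1)\<close> in the numerator. The surplus factor \<open>w\<close> is what makes the
  conjugate moments vanish.\<close>

lemma cnj_dual_quot_mult_blaschke: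
  assumes "admissible n a" "cmod z < 1" "cmod w = 1" "n \<ge> 1"
  shows "cnj (dual_quot n a b z w) * blaschke n a z w = w * quot n a b (z * w)"
proof -
  note w = cnj_unimodular[OF assms(3)]
  have "w * cnj (cnj z - cnj (b k) * w) = z * w - b k" for k
    using w by (simp add: field_simps)
  then have "(\<Prod>k=1..n-1. w * cnj (cnj z - cnj (b k) * w)) = (\<Prod>k=1..n-1. z * w - b k)"
    by (intro prod.cong refl)
  then have Q: "w ^ (n - 1) * cnj (\<Prod>k=1..n-1. cnj z - cnj (b k) * w) = (\<Prod>k=1..n-1. z * w - b k)"
    by (simp add: prod.distrib del: complex_cnj_diff complex_cnj_mult)
  have "w * cnj (1 - z * cnj (a k) * w) = w - cnj z * a k" if "k \<in> {1..n}" for k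
    using blaschke_factor_reflection(2)[OF assms(3)] that assms(1) by (auto simp: admissible_def)
  then have "(\<Prod>k=1..n. w * cnj (1 - z * cnj (a k) * w)) = (\<Prod>k=1..n. w - cnj z * a k)"
    by (rule prod.cong[OF refl])
  then have D: "w ^ n * cnj (\<Prod>k=1..n. 1 - z * cnj (a k) * w) = (\<Prod>k=1..n. w - cnj z * a k)"
    by (simp add: prod.distrib del: complex_cnj_diff complex_cnj_mult)
  have nz: "cnj (\<Prod>k=1..n. 1 - z * cnj (a k) * w) \<noteq> 0" "(\<Prod>k=1..n. z * w - a k) \<noteq> 0"
    using denominators_nonzero[OF assms(2)] assms(1,3)
    by (auto simp: admissible_def simp del: complex_cnj_diff complex_cnj_mult)
  have wn: "w ^ n = w * w ^ (n - 1)" using assms(4) by (cases n) auto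
  show ?thesis
    unfolding dual_quot_def blaschke_def quot_def Q[symmetric] D[symmetric] complex_cnj_divide wn
    using nz by (simp add: field_simps del: complex_cnj_diff complex_cnj_mult)
qed

lemma norm_dual_quot:
  assumes "admissible n a" "cmod z < 1" "cmod w = 1" "n \<ge> 1"
  shows "cmod (dual_quot n a b z w) = cmod (quot n a b (z * w))"
  using arg_cong[OF cnj_dual_quot_mult_blaschke[OF assms, of b], of cmod]
    norm_blaschke[OF assms(1-3)] assms(3)
  by (simp add: norm_mult)

lemma blaschke_0:
  assumes "admissible n a"
  shows "blaschke n a z 0 = cnj z ^ n"
proof -
  have "(\<Prod>k=1..n. (0 - cnj z * a k) / (z * 0 - a k)) = (\<Prod>k=1..n. cnj z)"
  proof (intro prod.cong refl)
    fix k assume "k \<in> {1..n}"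
    then have "cmod (a k) = 1" using assms unfolding admissible_def by blast
    then have "a k \<noteq> 0" by auto
    then show "(0 - cnj z * a k) / (z * 0 - a k) = cnj z" by simp
  qed
  also have "\<dots> = cnj z ^ n" by simp
  finally show ?thesis unfolding blaschke_def prod_dividef .
qed

lemma dual_quot_0: "dual_quot n a b z 0 = cnj z ^ (n - 1)"
  by (simp add: dual_quot_def)

section \<open>The symmetric configuration\<close>

text \<open>Both sides are monic of degree \<open>n\<close> in \<open>x\<close> and vanish at all
  \<open>n\<close> roots of unity.\<close>

lemma prod_diff_roots_of_unity:
  fixes x :: complex
  assumes "n \<ge> 1"
  shows "(\<Prod>k=1..n. x - roots_config n k) = x ^ n - 1"
proof -
  let ?S = "{z :: complex. z ^ n = 1}"
  have fin: "finite ?S" and card: "card ?S = n"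
    using assms finite_roots_unity card_complex_roots_unity by auto
  have rc: "roots_config n k = cis (2 * pi * real k / real n)" for k
    by (simp add: roots_config_def cis_conv_exp mult_ac)
  obtain m where m: "n = Suc m" using assms by (cases n) auto
  have "(\<Prod>k=1..n. x - roots_config n k) = (\<Prod>k<n. x - roots_config n (Suc k))"
    by (simp add: prod.atLeast1_atMost_eq)
  also have "\<dots> = (\<Prod>k<m. x - roots_config n (Suc k)) * (x - roots_config n n)"
    by (simp add: m)
  \<comment> \<open>The indices \<open>1..n\<close> are moved to \<open>0..n-1\<close>, the range of
    the standard bijection with the roots of unity.\<close>
  also have "roots_config n n = roots_config n 0"
    using assms by (simp add: rc)
  also have "(\<Prod>k<m. x - roots_config n (Suc k)) * (x - roots_config n 0) = (\<Prod>k<n. x - roots_config n k)"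
    unfolding m prod.lessThan_Suc_shift by simp
  also have "\<dots> = (\<Prod>\<zeta>\<in>?S. x - \<zeta>)"
    unfolding rc using Complex.bij_betw_roots_unity[of n, THEN prod.reindex_bij_betw, of "\<lambda>\<zeta>. x - \<zeta>"] assms by simp
  also have "\<dots> = poly (\<Prod>\<zeta>\<in>?S. [:-\<zeta>, 1:]) x"
    by (simp add: poly_prod)
  also have "(\<Prod>\<zeta>\<in>?S. [:-\<zeta>, 1:]) = monom 1 n - 1"
  proof (rule poly_eqI_degree_lead_coeff[where A = ?S and n = n])
    show "degree (\<Prod>\<zeta>\<in>?S. [:-\<zeta>, 1:]) \<le> n"
      using degree_prod_sum_le[OF fin, of "\<lambda>\<zeta>. [:-\<zeta>, 1:]"] card by simp
    have "lead_coeff (\<Prod>\<zeta>\<in>?S. [:-\<zeta>, 1:]) = 1" by (simp add: lead_coeff_prod)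
    moreover have "degree (\<Prod>\<zeta>\<in>?S. [:-\<zeta>, 1:]) = n"
      using card by (subst degree_prod_eq_sum_degree) auto
    ultimately show "coeff (\<Prod>\<zeta>\<in>?S. [:-\<zeta>, 1:]) n = coeff (monom 1 n - 1) n"
      using assms by (simp add: coeff_1)
    show "degree (monom (1::complex) n - 1) \<le> n"
      by (intro degree_diff_le) (auto simp: degree_monom_le)
    show "poly (\<Prod>\<zeta>\<in>?S. [:-\<zeta>, 1:]) y = poly (monom 1 n - 1) y" if "y \<in> ?S" for y
    proof -
      have "(\<Prod>\<zeta>\<in>?S. y - \<zeta>) = 0" using that fin by (intro prod_zero) auto
      then show ?thesis using that by (simp add: poly_prod poly_monom)
    qed
  qed (use fin card in auto)
  also have "poly (monom 1 n - 1) x = x ^ n - 1"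
    by (simp add: poly_monom)
  finally show ?thesis .
qed

lemma admissible_roots_config: "admissible n (roots_config n)"
proof -
  have "roots_config n k = cis (2 * pi * real k / real n)" for k
    by (simp add: roots_config_def cis_conv_exp mult_ac)
  then show ?thesis by (simp add: admissible_def)
qed

text \<open>With \<open>b = 0\<close> and poles at the roots of unity, both functions depend on
  \<open>w\<close> only through \<open>w ^ n\<close>. The Blaschke product is a Moebius function of
  \<open>w ^ n\<close>, so \<open>w ^ n\<close> can be eliminated.\<close>

lemma dual_quot_roots_config:
  assumes "n \<ge> 1" "0 < cmod z" "cmod z < 1" "cmod w = 1"
  defines "a \<equiv> roots_config n"
  shows "dual_quot n a (\<lambda>_. 0) z w =
    cnj z ^ (n - 1) * (1 - z ^ n * blaschke n a z w) / (1 - (z * cnj z) ^ n)"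
proof -
  have z: "z \<noteq> 0" using assms by auto
  note w = cnj_unimodular[OF assms(4)]
  have num: "(\<Prod>k=1..n. w - cnj z * a k) = w ^ n - cnj z ^ n"
  proof -
    have "(\<Prod>k=1..n. w - cnj z * a k) = (\<Prod>k=1..n. cnj z * (w / cnj z - a k))"
      using z by (intro prod.cong) (auto simp: field_simps)
    also have "\<dots> = cnj z ^ n * ((w / cnj z) ^ n - 1)"
      by (simp only: prod.distrib prod_diff_roots_of_unity[OF assms(1)] a_def) simp
    also have "\<dots> = w ^ n - cnj z ^ n"
      using z by (simp add: power_divide right_diff_distrib)
    finally show ?thesis .
  qed
  have den: "(\<Prod>k=1..n. z * w - a k) = z ^ n * w ^ n - 1"
    by (simp only: prod_diff_roots_of_unity[OF assms(1)] a_def power_mult_distrib)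
  have dual: "(\<Prod>k=1..n. 1 - z * cnj (a k) * w) = 1 - z ^ n * w ^ n"
  proof -
    \<comment> \<open>Factoring out \<open>z * w\<close> and conjugating produces a product of terms
      \<open>x - a k\<close> with \<open>x = cnj (1 / (z * w))\<close>.\<close>
    have "(\<Prod>k=1..n. 1 - z * cnj (a k) * w) = (\<Prod>k=1..n. (z * w) * cnj (cnj (1 / (z * w)) - a k))"
      using z w by (intro prod.cong) (auto simp: field_simps)
    also have "\<dots> = (z * w) ^ n * cnj ((cnj (1 / (z * w))) ^ n - 1)"
      by (simp only: prod.distrib prod_diff_roots_of_unity[OF assms(1)] a_def flip: cnj_prod) (simp add: power_mult_distrib)
    also have "\<dots> = 1 - z ^ n * w ^ n"
    proof -
      have "u ^ n * cnj ((cnj (1 / u)) ^ n - 1) = 1 - u ^ n" if "u \<noteq> 0" for u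
        using that by (simp add: power_one_over right_diff_distrib)
      from this[of "z * w"] show ?thesis using z w by (simp only: power_mult_distrib) simp
    qed
    finally show ?thesis .
  qed
  have "cmod (z * w) < 1" "cmod (z * cnj z) < 1"
    using assms norm_mult_less_1[of z] by auto
  then have "cmod (z ^ n * w ^ n) < 1" "cmod ((z * cnj z) ^ n) < 1"
    using assms(1) unfolding power_mult_distrib[symmetric] norm_power
    by (simp_all add: power_less_one_iff)
  then have "z ^ n * w ^ n - 1 \<noteq> 0" "1 - (z * cnj z) ^ n \<noteq> 0" by auto
  then have nz: "z ^ n * w ^ n - 1 \<noteq> 0" "1 - z ^ n * w ^ n \<noteq> 0" by auto
  have "1 - z ^ n * ((w ^ n - cnj z ^ n) / (z ^ n * w ^ n - 1)) =
      (1 - z ^ n * cnj z ^ n) / (1 - z ^ n * w ^ n)"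
    using nz by (simp add: divide_simps) (simp add: algebra_simps)
  then show ?thesis
    using \<open>1 - (z * cnj z) ^ n \<noteq> 0\<close>
    unfolding blaschke_def dual_quot_def num den dual by (simp add: power_mult_distrib)
qed

subsection \<open>Minimality on a circle\<close>

text \<open>Each mean is the value at 0 of a function holomorphic on the closed disc, or the
  conjugate of such a value. The last two moments, without \<open>dual_quot\<close>, serve the terms
  that depend on the Blaschke product alone.\<close>

lemma circle_moments:
  assumes "admissible n a" "cmod z < 1" "n \<ge> 1"
  shows "integral {0..1} (\<lambda>t. dual_quot n a b z (circ t) * blaschke n a z (circ t) ^ m) =
           cnj z ^ (n - 1) * (cnj z ^ n) ^ m" (is ?A)
    and "integral {0..1} (\<lambda>t. dual_quot n a b z (circ t) * cnj (blaschke n a z (circ t)) ^ m) =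
           (if m = 0 then cnj z ^ (n - 1) else 0)" (is ?B)
    and "integral {0..1} (\<lambda>t. blaschke n a z (circ t) ^ m) = (cnj z ^ n) ^ m" (is ?C)
    and "integral {0..1} (\<lambda>t. cnj (blaschke n a z (circ t)) ^ m) = (z ^ n) ^ m" (is ?D)
proof -
  note hol = holomorphic_blaschke[OF assms(1,2)] holomorphic_dual_quot[OF assms(1,2), of b]
    holomorphic_quot[OF assms(1,2), of b]
  note at_0 = blaschke_0[OF assms(1), of z] dual_quot_0[of n a b z]
  have A: "integral {0..1} (\<lambda>t. dual_quot n a b z (circ t) * blaschke n a z (circ t) ^ m) =
           cnj z ^ (n - 1) * (cnj z ^ n) ^ m" for m :: nat
  proof -
    have "(\<lambda>w. dual_quot n a b z w * blaschke n a z w ^ m) holomorphic_on cball 0 1"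
      by (intro holomorphic_intros hol)
    from integral_unique[OF mean_value_circ[OF this]] show ?thesis
      by (simp add: at_0)
  qed
  then show ?A .
  have "(\<lambda>w. blaschke n a z w ^ m) holomorphic_on cball 0 1"
    by (intro holomorphic_intros hol)
  from integral_unique[OF mean_value_circ[OF this]] show C: ?C
    by (simp add: at_0)
  have "integral {0..1} (\<lambda>t. cnj (blaschke n a z (circ t) ^ m)) = cnj ((cnj z ^ n) ^ m)"
    by (simp only: integral_cnj[symmetric] C)
  then show ?D by simp
  show ?B
  proof (cases m)
    case 0
    then show ?thesis using A[of 0] by simp
  next
    case (Suc l)
    \<comment> \<open>One Blaschke factor is absorbed by the conjugate of \<open>dual_quot\<close>;
      what remains is holomorphic and, thanks to the factor \<open>w\<close>, zero at 0.\<close>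
    have eq: "dual_quot n a b z (circ t) * cnj (blaschke n a z (circ t)) ^ m =
      cnj (circ t * quot n a b (z * circ t) * blaschke n a z (circ t) ^ l)" for t
    proof -
      have "circ t * quot n a b (z * circ t) * blaschke n a z (circ t) ^ l =
          cnj (dual_quot n a b z (circ t)) * blaschke n a z (circ t) ^ m"
        by (subst cnj_dual_quot_mult_blaschke[symmetric]) (use assms Suc in auto)
      then show ?thesis by simp
    qed
    have "integral {0..1} (\<lambda>t. circ t * quot n a b (z * circ t) * blaschke n a z (circ t) ^ l) = 0"
    proof -
      have "(\<lambda>w. w * quot n a b (z * w) * blaschke n a z w ^ l) holomorphic_on cball 0 1"
        by (intro holomorphic_intros hol)
      from integral_unique[OF mean_value_circ[OF this]] show ?thesis
        by simp
    qed
    then show ?thesis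
      unfolding eq integral_cnj[symmetric] using Suc by simp
  qed
qed

lemma continuous_on_circle:
  assumes "admissible n a" "cmod z < 1"
  shows "continuous_on {0..1} (\<lambda>t. blaschke n a z (circ t))"
    and "continuous_on {0..1} (\<lambda>t. dual_quot n a b z (circ t))"
    and "continuous_on {0..1} (\<lambda>t. quot n a b (z * circ t))"
proof -
  have *: "continuous_on {0..1} (\<lambda>t. f (circ t))" if "f holomorphic_on cball 0 1" for f
    by (rule continuous_on_compose2[OF holomorphic_on_imp_continuous_on[OF that] continuous_on_circ]) auto
  show "continuous_on {0..1} (\<lambda>t. blaschke n a z (circ t))"
    and "continuous_on {0..1} (\<lambda>t. dual_quot n a b z (circ t))"
    and "continuous_on {0..1} (\<lambda>t. quot n a b (z * circ t))"
    using assms by (auto intro: *[OF holomorphic_quot] * holomorphic_blaschke holomorphic_dual_quot)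
qed

text \<open>No value in \<open>circle_moments\<close> involves \<open>a\<close> or \<open>b\<close>,
  so \<open>trig_moments_determine\<close> applies with weight \<open>dual_quot\<close>, and again
  with weight 1.\<close>

lemma circle_integral_cong:
  assumes "admissible n a" "admissible n a'" "cmod z < 1" "n \<ge> 1" "continuous_on (sphere 0 1) H"
  shows "integral {0..1} (\<lambda>t. dual_quot n a b z (circ t) * H (blaschke n a z (circ t))) =
         integral {0..1} (\<lambda>t. dual_quot n a' b' z (circ t) * H (blaschke n a' z (circ t)))"
    and "integral {0..1} (\<lambda>t. H (blaschke n a z (circ t))) =
         integral {0..1} (\<lambda>t. H (blaschke n a' z (circ t)))"
proof -
  show "integral {0..1} (\<lambda>t. dual_quot n a b z (circ t) * H (blaschke n a z (circ t))) =
         integral {0..1} (\<lambda>t. dual_quot n a' b' z (circ t) * H (blaschke n a' z (circ t)))"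
    by (rule trig_moments_determine[where ?g1.0 = "\<lambda>t. dual_quot n a b z (circ t)"
        and ?g2.0 = "\<lambda>t. dual_quot n a' b' z (circ t)" and
        ?e1.0 = "\<lambda>t. blaschke n a z (circ t)" and ?e2.0 = "\<lambda>t. blaschke n a' z (circ t)"])
      (use assms in \<open>simp_all add: continuous_on_circle norm_blaschke circle_moments\<close>)
  have "integral {0..1} (\<lambda>t. 1 * H (blaschke n a z (circ t))) =
         integral {0..1} (\<lambda>t. 1 * H (blaschke n a' z (circ t)))"
    by (rule trig_moments_determine[where ?g1.0 = "\<lambda>_. 1" and ?g2.0 = "\<lambda>_. 1" and
        ?e1.0 = "\<lambda>t. blaschke n a z (circ t)" and ?e2.0 = "\<lambda>t. blaschke n a' z (circ t)"])
      (use assms in \<open>simp_all add: continuous_on_circle norm_blaschke circle_moments\<close>)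
  then show "integral {0..1} (\<lambda>t. H (blaschke n a z (circ t))) =
         integral {0..1} (\<lambda>t. H (blaschke n a' z (circ t)))"
    by simp
qed

section \<open>Even convex functions and their approximate subgradients\<close>

text \<open>The point \<open>x\<close> is a convex combination of \<open>- y\<close> and
  \<open>y\<close>, where the values of \<open>\<Psi>\<close> agree.\<close>

lemma even_convex_mono:
  fixes \<Psi> :: "real \<Rightarrow> real"
  assumes "convex_on UNIV \<Psi>" "\<And>x. \<Psi> (- x) = \<Psi> x" "0 \<le> x" "x \<le> y"
  shows "\<Psi> x \<le> \<Psi> y"
proof (cases "y = 0")
  case False
  define u where "u = (1 + x / y) / 2"
  have u: "0 \<le> u" "u \<le> 1" using assms False by (auto simp: u_def field_simps)
  have "\<Psi> ((1 - u) *\<^sub>R (- y) + u *\<^sub>R y) \<le> (1 - u) * \<Psi> (- y) + u * \<Psi> y"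
    using assms(1) u by (intro convex_onD) auto
  also have "(1 - u) *\<^sub>R (- y) + u *\<^sub>R y = x"
    using False by (simp add: u_def field_simps)
  finally show ?thesis by (simp add: assms(2) algebra_simps)
qed (use assms in auto)

text \<open>
  A forward difference quotient is an approximate subgradient which, unlike a subgradient, is
  continuous.
\<close>
lemma continuous_approx_subgradient:
  fixes \<Psi> :: "real \<Rightarrow> real"
  assumes conv: "convex_on UNIV \<Psi>" and even: "\<And>x. \<Psi> (- x) = \<Psi> x" and "e > 0"
  obtains \<sigma> where "continuous_on UNIV \<sigma>" "\<And>x. x \<ge> 0 \<Longrightarrow> \<sigma> x \<ge> 0"
    "\<And>x y. 0 \<le> x \<Longrightarrow> x \<le> M \<Longrightarrow> \<Psi> y \<ge> \<Psi> x + \<sigma> x * (y - x) - e"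
proof -
  have cont: "continuous_on UNIV \<Psi>"
    using convex_on_continuous[OF open_UNIV conv] .
  \<comment> \<open>The extra unit leaves room for \<open>x + \<delta>\<close> with
    \<open>x \<le> M\<close> and \<open>\<delta> \<le> 1\<close>.\<close>
  have "uniformly_continuous_on {0..M+1} \<Psi>"
    by (rule compact_uniformly_continuous[OF continuous_on_subset[OF cont]]) auto
  then obtain d where d: "d > 0"
    "\<And>x y. x \<in> {0..M+1} \<Longrightarrow> y \<in> {0..M+1} \<Longrightarrow> \<bar>y - x\<bar> < d \<Longrightarrow> \<bar>\<Psi> y - \<Psi> x\<bar> < e"
    using \<open>e > 0\<close> unfolding uniformly_continuous_on_def dist_real_def by metis
  define \<delta> where "\<delta> = min 1 (d / 2)"
  have \<delta>: "0 < \<delta>" "\<delta> \<le> 1" "\<delta> < d" using d(1) by (auto simp: \<delta>_def)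
  define \<sigma> where "\<sigma> x = (\<Psi> (x + \<delta>) - \<Psi> x) / \<delta>" for x
  \<comment> \<open>The line through two points of a convex graph lies below the graph outside the
    interval between them.\<close>
  have slope: "\<Psi> v \<ge> \<Psi> x + (\<Psi> u - \<Psi> x) / (u - x) * (v - x)" if "x < u" "u \<le> v \<or> v \<le> x" for u v x
  proof -
    have "(u = v \<or> v = x) \<or> u < v \<or> v < x" using that by linarith
    then consider "u = v \<or> v = x" | "u < v" | "v < x" by blast
    then show ?thesis
    proof cases
      case 2
      have "(\<Psi> x - \<Psi> u) / (x - u) \<le> (\<Psi> x - \<Psi> v) / (x - v)"
        using convex_on_slope_le(1)[OF conv, of x v u] that 2 by auto
      then show ?thesis using that 2 by (simp add: field_simps)
    next
      case 3
      have "(\<Psi> v - \<Psi> x) / (v - x) \<le> (\<Psi> x - \<Psi> u) / (x - u)"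
        using convex_on_slope_le[OF conv, of v u x] that 3 by auto
      then show ?thesis using that 3 by (simp add: field_simps)
    qed (use that in auto)
  qed
  show thesis
  proof
    show "continuous_on UNIV \<sigma>"
      unfolding \<sigma>_def using \<delta>
      by (intro continuous_intros continuous_on_compose2[OF cont]) auto
    show \<sigma>_nonneg: "\<sigma> x \<ge> 0" if "x \<ge> 0" for x
      using even_convex_mono[OF conv even that, of "x + \<delta>"] \<delta> by (simp add: \<sigma>_def)
    show "\<Psi> y \<ge> \<Psi> x + \<sigma> x * (y - x) - e" if "0 \<le> x" "x \<le> M" for x y
    proof (cases "x + \<delta> \<le> y \<or> y \<le> x")
      case True
      then have "\<Psi> y \<ge> \<Psi> x + \<sigma> x * (y - x)"
        using slope[of x "x + \<delta>" y] \<delta> by (simp add: \<sigma>_def)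
      then show ?thesis using \<open>e > 0\<close> by simp
    next
      case False
      \<comment> \<open>Strictly between \<open>x\<close> and \<open>x + \<delta>\<close> the secant
        may exceed \<open>\<Psi>\<close>, but it stays below \<open>\<Psi> (x + \<delta>)\<close>,
        which is within \<open>e\<close> of \<open>\<Psi> y\<close>.\<close>
      have "\<sigma> x * (y - x) \<le> \<sigma> x * \<delta>"
        using \<sigma>_nonneg[OF that(1)] False by (intro mult_left_mono) auto
      also have "\<dots> = \<Psi> (x + \<delta>) - \<Psi> x" using \<delta> by (simp add: \<sigma>_def)
      finally have "\<Psi> x + \<sigma> x * (y - x) \<le> \<Psi> (x + \<delta>)" by simp
      moreover have "\<bar>\<Psi> (x + \<delta>) - \<Psi> y\<bar> < e"
        using that False \<delta> by (intro d(2)) auto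
      ultimately show ?thesis by simp
    qed
  qed
qed

text \<open>A minorant of the modulus that is real-linear in \<open>w\<close>, with equality at
  \<open>w = v\<close>.\<close>

lemma Re_mult_cnj_sgn_le: "Re (w * cnj (sgn v)) \<le> cmod w"
proof -
  have "Re (w * cnj (sgn v)) \<le> cmod w * cmod (sgn v)"
    using complex_Re_le_cmod[of "w * cnj (sgn v)"] by (simp add: norm_mult)
  also have "\<dots> \<le> cmod w * 1" by (intro mult_left_mono) (auto simp: norm_sgn)
  finally show ?thesis by simp
qed

text \<open>The subgradient argument with slack \<open>e\<close>: \<open>Re (F a b t)\<close> lies
  below the integrand, has a mean common to all configurations, and misses the integrand of the
  symmetric one by exactly \<open>e\<close>. Then \<open>e\<close> tends to 0.\<close>

lemma circle_mean_minimal: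
  fixes \<Psi> :: "real \<Rightarrow> real"
  assumes conv: "convex_on UNIV \<Psi>" and even: "\<And>x. \<Psi> (- x) = \<Psi> x"
    and n: "n \<ge> 1" and z: "0 < cmod z" "cmod z < 1" and adm: "admissible n a"
  shows "integral {0..1} (\<lambda>t. \<Psi> (cmod (quot n (roots_config n) (\<lambda>_. 0) (z * circ t))))
       \<le> integral {0..1} (\<lambda>t. \<Psi> (cmod (quot n a b (z * circ t))))" (is "?L \<le> ?R")
proof (rule field_le_epsilon)
  fix e :: real assume "e > 0"
  have cont: "continuous_on UNIV \<Psi>"
    using convex_on_continuous[OF open_UNIV conv] .
  let ?a = "roots_config n" and ?b = "\<lambda>_::nat. 0::complex"
  note adm' = admissible_roots_config[of n]
  define k where "k s = cnj z ^ (n - 1) * (1 - z ^ n * s) / (1 - (z * cnj z) ^ n)" for s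
  have k_eq: "dual_quot n ?a ?b z (circ t) = k (blaschke n ?a z (circ t))" for t
    unfolding k_def using dual_quot_roots_config[OF n z, of "circ t"] by simp
  have "cmod ((z * cnj z) ^ n) < 1"
    using n z norm_mult_less_1[of z "cnj z"] unfolding norm_power
    by (simp add: power_less_one_iff)
  then have den: "1 - (z * cnj z) ^ n \<noteq> 0" by auto
  \<comment> \<open>Needed for continuity of \<open>sgn (k s)\<close>, and so of
    \<open>H\<close>.\<close>
  have k_nz: "k s \<noteq> 0" if "cmod s = 1" for s
  proof -
    have "cmod (z ^ n * s) < 1"
      using n z that by (simp add: norm_mult norm_power power_less_one_iff)
    then have "1 - z ^ n * s \<noteq> 0" by auto
    then show ?thesis using den z by (auto simp: k_def)
  qed
  have k_cont: "continuous_on (sphere 0 1) k"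
    unfolding k_def using den by (intro continuous_intros) auto
  obtain M where M: "\<And>s. cmod s = 1 \<Longrightarrow> cmod (k s) \<le> M"
    using compact_imp_bounded[OF compact_continuous_image[OF k_cont compact_sphere]]
    unfolding bounded_iff by (metis imageI mem_sphere_0)
  obtain \<sigma> where \<sigma>: "continuous_on UNIV \<sigma>" "\<And>x. x \<ge> 0 \<Longrightarrow> \<sigma> x \<ge> 0"
    "\<And>x y. 0 \<le> x \<Longrightarrow> x \<le> M \<Longrightarrow> \<Psi> y \<ge> \<Psi> x + \<sigma> x * (y - x) - e"
    by (rule continuous_approx_subgradient[OF conv even \<open>e > 0\<close>, where M = M]) blast
  \<comment> \<open>The approximate tangent at \<open>cmod (k s)\<close>, split into the coefficient
    \<open>H\<close> of \<open>dual_quot\<close> and the remaining terms \<open>\<phi>\<close>; both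
    depend only on the Blaschke value \<open>s\<close>.\<close>
  define H where "H s = complex_of_real (\<sigma> (cmod (k s))) * cnj (sgn (k s))" for s
  define \<phi> where "\<phi> s = complex_of_real (\<Psi> (cmod (k s)) - \<sigma> (cmod (k s)) * cmod (k s) - e)" for s
  have \<sigma>k: "continuous_on (sphere 0 1) (\<lambda>s. \<sigma> (cmod (k s)))"
    and \<Psi>k: "continuous_on (sphere 0 1) (\<lambda>s. \<Psi> (cmod (k s)))"
    by (rule continuous_on_compose2[OF \<sigma>(1) continuous_on_norm[OF k_cont]]
        continuous_on_compose2[OF cont continuous_on_norm[OF k_cont]]; simp)+
  have H_cont: "continuous_on (sphere 0 1) H"
    unfolding H_def using k_nz
    by (intro continuous_intros k_cont \<sigma>k) auto
  have \<phi>_cont: "continuous_on (sphere 0 1) \<phi>"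
    unfolding \<phi>_def
    by (intro continuous_intros k_cont \<sigma>k \<Psi>k)
  define F where "F a b t = dual_quot n a b z (circ t) * H (blaschke n a z (circ t)) +
    \<phi> (blaschke n a z (circ t))" for a b t
  have F_int: "F a b integrable_on {0..1}"
    and F_eq: "integral {0..1} (F a b) =
      integral {0..1} (\<lambda>t. dual_quot n a b z (circ t) * H (blaschke n a z (circ t))) +
      integral {0..1} (\<lambda>t. \<phi> (blaschke n a z (circ t)))" if a: "admissible n a" for a b
  proof -
    have sph: "(\<lambda>t. blaschke n a z (circ t)) ` {0..1} \<subseteq> sphere 0 1"
      using norm_blaschke[OF a z(2)] by auto
    have "continuous_on {0..1} (\<lambda>t. dual_quot n a b z (circ t) * H (blaschke n a z (circ t)))"
      "continuous_on {0..1} (\<lambda>t. \<phi> (blaschke n a z (circ t)))"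
      by (intro continuous_on_mult continuous_on_circle(2)[OF a z(2)]
          continuous_on_compose2[OF H_cont continuous_on_circle(1)[OF a z(2)] sph]
          continuous_on_compose2[OF \<phi>_cont continuous_on_circle(1)[OF a z(2)] sph])+
    note this[THEN integrable_continuous_real]
    then show "F a b integrable_on {0..1}"
      "integral {0..1} (F a b) =
      integral {0..1} (\<lambda>t. dual_quot n a b z (circ t) * H (blaschke n a z (circ t))) +
      integral {0..1} (\<lambda>t. \<phi> (blaschke n a z (circ t)))"
      unfolding F_def by (rule integrable_add integral_add; simp)+
  qed
  have "integral {0..1} (F ?a ?b) = integral {0..1} (F a b)"
    unfolding F_eq[OF adm] F_eq[OF adm']
    using circle_integral_cong(1)[OF adm' adm z(2) n H_cont, of ?b b]
      circle_integral_cong(2)[OF adm' adm z(2) n \<phi>_cont] by simp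
  then have F_cong: "integral {0..1} (\<lambda>t. Re (F ?a ?b t)) = integral {0..1} (\<lambda>t. Re (F a b t))"
    using has_integral_Re[OF integrable_integral[OF F_int[OF adm, of b]], THEN integral_unique]
      has_integral_Re[OF integrable_integral[OF F_int[OF adm', of ?b]], THEN integral_unique] by simp
  have \<Psi>_int: "(\<lambda>t. \<Psi> (cmod (quot n a b (z * circ t)))) integrable_on {0..1}"
    if "admissible n a" for a b
    by (intro integrable_continuous_real
      continuous_on_compose2[OF cont continuous_on_norm[OF continuous_on_circle(3)[OF that z(2)]]]) auto
  have lower: "Re (F a b t) \<le> \<Psi> (cmod (quot n a b (z * circ t)))" for t
  proof -
    define s where "s = blaschke n a z (circ t)"
    define K where "K = dual_quot n a b z (circ t)"
    have s: "cmod s = 1" unfolding s_def by (rule norm_blaschke[OF adm z(2)]) simp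
    have "Re (F a b t) = \<sigma> (cmod (k s)) * Re (K * cnj (sgn (k s))) + Re (\<phi> s)"
      by (simp add: F_def H_def s_def K_def algebra_simps)
    \<comment> \<open>Monotonicity of \<open>\<Psi>\<close> on the half line enters here, as the
      sign of \<open>\<sigma>\<close>.\<close>
    also have "\<dots> \<le> \<sigma> (cmod (k s)) * cmod K + Re (\<phi> s)"
      by (intro add_right_mono mult_left_mono Re_mult_cnj_sgn_le \<sigma>) auto
    also have "\<dots> = \<Psi> (cmod (k s)) + \<sigma> (cmod (k s)) * (cmod K - cmod (k s)) - e"
      by (simp add: \<phi>_def algebra_simps)
    also have "\<dots> \<le> \<Psi> (cmod K)"
      by (intro \<sigma> M s) auto
    also have "cmod K = cmod (quot n a b (z * circ t))"
      unfolding K_def by (rule norm_dual_quot[OF adm z(2) _ n]) simp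
    finally show ?thesis .
  qed
  have equal: "Re (F ?a ?b t) = \<Psi> (cmod (quot n ?a ?b (z * circ t))) - e" for t
  proof -
    define s where "s = blaschke n ?a z (circ t)"
    have "cmod s = 1" unfolding s_def by (rule norm_blaschke[OF adm' z(2)]) simp
    then have "k s * cnj (sgn (k s)) = cmod (k s)"
      using k_nz by (simp add: sgn_eq complex_norm_square[symmetric] power2_eq_square)
    moreover have "F ?a ?b t = \<sigma> (cmod (k s)) * (k s * cnj (sgn (k s))) + \<phi> s"
      by (simp add: F_def H_def s_def k_eq algebra_simps)
    ultimately have "Re (F ?a ?b t) = \<Psi> (cmod (k s)) - e"
      by (simp add: \<phi>_def)
    also have "cmod (k s) = cmod (quot n ?a ?b (z * circ t))"
      unfolding s_def k_eq[symmetric] by (rule norm_dual_quot[OF adm' z(2) _ n]) simp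
    finally show ?thesis .
  qed
  have "?L - e = integral {0..1} (\<lambda>t. \<Psi> (cmod (quot n ?a ?b (z * circ t))) - e)"
    using \<Psi>_int[OF adm'] by (subst integral_diff) auto
  also have "\<dots> = integral {0..1} (\<lambda>t. Re (F a b t))"
    unfolding F_cong[symmetric] equal ..
  also have "\<dots> \<le> ?R"
    using lower \<Psi>_int[OF adm] has_integral_Re[OF integrable_integral[OF F_int[OF adm, of b]]]
    by (intro integral_le) (auto simp: integrable_on_def)
  finally show "?L \<le> ?R + e" by simp
qed

subsection \<open>Area measure in the disc\<close>

lemma cball_borel [measurable]: "cball x r \<in> sets borel"
  by (rule borel_closed[OF closed_cball])

lemma nn_integral_lborel_translate:
  fixes c :: "'a :: euclidean_space"
  assumes [measurable]: "f \<in> borel_measurable borel"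
  shows "(\<integral>\<^sup>+x. f (c + x) \<partial>lborel) = (\<integral>\<^sup>+x. f x \<partial>lborel)"
proof -
  have "(\<integral>\<^sup>+x. f x \<partial>lborel) = (\<integral>\<^sup>+x. f x \<partial>distr lborel borel ((+) c))"
    by (simp only: lborel_distr_plus)
  also have "\<dots> = (\<integral>\<^sup>+x. f (c + x) \<partial>lborel)"
    by (subst nn_integral_distr) auto
  finally show ?thesis ..
qed

text \<open>
  Uniqueness of Haar measure in miniature: evaluating
  \<open>\<integral>\<integral> 1\<^sub>A (w x + y) 1\<^sub>B (y) dy dx\<close> for the unit disc \<open>B\<close> in both orders shows that the area
  of \<open>A\<close> equals the area of its preimage under multiplication by \<open>w\<close>.
\<close>
lemma lborel_distr_rotation:
  fixes w :: complex
  assumes w: "cmod w = 1"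
  shows "distr lborel borel (\<lambda>z. w * z) = lborel"
proof (rule measure_eqI)
  fix A assume "A \<in> sets (distr lborel borel (\<lambda>z. w * z))"
  then have [measurable]: "A \<in> sets borel" by simp
  have w0: "w \<noteq> 0" using w by auto
  let ?B = "cball (0::complex) 1"
  define \<beta> where "\<beta> = emeasure lborel ?B"
  have \<beta>: "emeasure lborel (cball c 1) = \<beta>" for c :: complex
    unfolding \<beta>_def by (simp add: emeasure_cball)
  have \<beta>_pos: "\<beta> \<noteq> 0" "\<beta> \<noteq> \<infinity>"
    unfolding \<beta>_def by (auto simp: emeasure_cball unit_ball_vol_2)
  have "(\<integral>\<^sup>+y. \<integral>\<^sup>+x. indicator A (w * x + y) * indicator ?B y \<partial>lborel \<partial>lborel) =
      (\<integral>\<^sup>+y. emeasure (distr lborel borel (\<lambda>z. w * z)) A * indicator ?B y \<partial>lborel)"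
  proof (rule nn_integral_cong)
    fix y :: complex
    have "(\<integral>\<^sup>+x. indicator A (w * x + y) * indicator ?B y \<partial>lborel) =
        (\<integral>\<^sup>+x. indicator A (w * (y / w + x)) \<partial>lborel) * indicator ?B y"
      using w0 by (subst nn_integral_multc[symmetric]) (auto simp: distrib_left add.commute)
    \<comment> \<open>Translation by \<open>y / w\<close> removes \<open>y\<close> from the inner
      integral.\<close>
    also have "(\<integral>\<^sup>+x. indicator A (w * (y / w + x)) \<partial>lborel) = (\<integral>\<^sup>+x. indicator A (w * x) \<partial>lborel)"
      by (rule nn_integral_lborel_translate[of "\<lambda>x. indicator A (w * x)"]) measurable
    also have "\<dots> = (\<integral>\<^sup>+x. indicator A x \<partial>distr lborel borel (\<lambda>z. w * z))"
      by (subst nn_integral_distr) auto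
    also have "\<dots> = emeasure (distr lborel borel (\<lambda>z. w * z)) A"
      by simp
    finally show "(\<integral>\<^sup>+x. indicator A (w * x + y) * indicator ?B y \<partial>lborel) =
      emeasure (distr lborel borel (\<lambda>z. w * z)) A * indicator ?B y" .
  qed
  also have "\<dots> = emeasure (distr lborel borel (\<lambda>z. w * z)) A * \<beta>"
    by (simp add: nn_integral_cmult_indicator \<beta>_def)
  finally have 1: "(\<integral>\<^sup>+y. \<integral>\<^sup>+x. indicator A (w * x + y) * indicator ?B y \<partial>lborel \<partial>lborel) =
    emeasure (distr lborel borel (\<lambda>z. w * z)) A * \<beta>" .
  have "(\<integral>\<^sup>+y. \<integral>\<^sup>+x. indicator A (w * x + y) * indicator ?B y \<partial>lborel \<partial>lborel) =
      (\<integral>\<^sup>+x. \<integral>\<^sup>+y. indicator A (w * x + y) * indicator ?B y \<partial>lborel \<partial>lborel)"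
    by (rule lborel_pair.Fubini') measurable
  also have "\<dots> = (\<integral>\<^sup>+x. \<integral>\<^sup>+y. indicator A y * indicator ?B (y - w * x) \<partial>lborel \<partial>lborel)"
  proof (rule nn_integral_cong)
    fix x :: complex
    show "(\<integral>\<^sup>+y. indicator A (w * x + y) * indicator ?B y \<partial>lborel) =
        (\<integral>\<^sup>+y. indicator A y * indicator ?B (y - w * x) \<partial>lborel)"
      using nn_integral_lborel_translate[of "\<lambda>y. indicator A y * indicator ?B (y - w * x)" "w * x"]
      by simp
  qed
  also have "\<dots> = (\<integral>\<^sup>+y. \<integral>\<^sup>+x. indicator A y * indicator ?B (y - w * x) \<partial>lborel \<partial>lborel)"
    by (rule lborel_pair.Fubini') measurable
  also have "\<dots> = (\<integral>\<^sup>+y. \<beta> * indicator A y \<partial>lborel)"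
  proof (rule nn_integral_cong)
    fix y :: complex
    \<comment> \<open>As a condition on \<open>x\<close>, lying in the disc about \<open>y\<close>
      after rotation means lying in the unit disc about \<open>y / w\<close>, because
      \<open>w\<close> is unimodular.\<close>
    have "cmod (w * x - y) = cmod (y / w - x)" for x
    proof -
      have "w * x - y = - w * (y / w - x)" using w0 by (simp add: algebra_simps)
      then show ?thesis by (simp add: norm_mult w)
    qed
    then have "indicator ?B (y - w * x) = (indicator (cball (y / w) 1) x :: ennreal)" for x
      by (auto simp: indicator_def dist_norm)
    then show "(\<integral>\<^sup>+x. indicator A y * indicator ?B (y - w * x) \<partial>lborel) = \<beta> * indicator A y"
      by (simp add: nn_integral_cmult \<beta> mult.commute)
  qed
  also have "\<dots> = emeasure lborel A * \<beta>"
    by (simp add: nn_integral_cmult mult.commute)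
  finally have "emeasure (distr lborel borel (\<lambda>z. w * z)) A * \<beta> = emeasure lborel A * \<beta>"
    unfolding 1 .
  then show "emeasure (distr lborel borel (\<lambda>z. w * z)) A = emeasure lborel A"
    using \<beta>_pos by (metis ennreal_mult_divide_eq infinity_ennreal_def)
qed simp

section \<open>Rotational averages and polar coordinates\<close>

lemma borel_measurable_circ [measurable]: "circ \<in> borel_measurable borel"
  by (rule borel_measurable_continuous_onI[OF continuous_on_circ])

text \<open>Each rotation preserves area, so after Fubini the inner integral is constant in
  \<open>t\<close> over an interval of length 1.\<close>

lemma nn_integral_rotation_average:
  fixes g :: "complex \<Rightarrow> ennreal"
  assumes [measurable]: "g \<in> borel_measurable borel"
  shows "(\<integral>\<^sup>+z. g z \<partial>lborel) =
    (\<integral>\<^sup>+z. \<integral>\<^sup>+t. g (z * circ t) * indicator {0..1} t \<partial>lborel \<partial>lborel)"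
proof -
  have "(\<integral>\<^sup>+z. \<integral>\<^sup>+t. g (z * circ t) * indicator {0..1} t \<partial>lborel \<partial>lborel) =
    (\<integral>\<^sup>+t. \<integral>\<^sup>+z. g (z * circ t) * indicator {0..1} t \<partial>lborel \<partial>lborel)"
    by (rule lborel_pair.Fubini') measurable
  also have "\<dots> = (\<integral>\<^sup>+t. (\<integral>\<^sup>+z. g z \<partial>lborel) * indicator {0..1::real} t \<partial>lborel)"
  proof (rule nn_integral_cong)
    fix t
    have "(\<integral>\<^sup>+z. g (z * circ t) * indicator {0..1} t \<partial>lborel) =
        (\<integral>\<^sup>+z. g (circ t * z) \<partial>lborel) * indicator {0..1} t"
      by (subst nn_integral_multc[symmetric]) (auto simp: mult.commute)
    also have "(\<integral>\<^sup>+z. g (circ t * z) \<partial>lborel) = (\<integral>\<^sup>+z. g z \<partial>distr lborel borel (\<lambda>z. circ t * z))"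
      by (subst nn_integral_distr) auto
    also have "\<dots> = (\<integral>\<^sup>+z. g z \<partial>lborel)"
      by (simp add: lborel_distr_rotation)
    finally show "(\<integral>\<^sup>+z. g (z * circ t) * indicator {0..1} t \<partial>lborel) =
      (\<integral>\<^sup>+z. g z \<partial>lborel) * indicator {0..1} t" .
  qed
  also have "\<dots> = (\<integral>\<^sup>+z. g z \<partial>lborel)"
    by (subst nn_integral_cmult) auto
  finally show ?thesis ..
qed

text \<open>The law of the modulus is compared on half lines: the area of the annulus outside radius
  \<open>x\<close> is the integral of \<open>2 * pi * r\<close>.\<close>

lemma distr_cmod_disc:
  "distr (density lborel (indicator (cball (0::complex) 1))) borel cmod =
   density lborel (\<lambda>r. ennreal (2 * pi * r) * indicator {0..1} r)" (is "?M = ?N")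
proof (rule measure_eqI_lessThan)
  fix x :: real
  have M: "emeasure ?M {x<..} = emeasure lborel (cball (0::complex) 1 \<inter> {z. x < cmod z})"
  proof -
    have "emeasure ?M {x<..} =
        emeasure (density lborel (indicator (cball (0::complex) 1))) {z. x < cmod z}"
      by (subst emeasure_distr) (auto intro!: arg_cong2[of _ _ _ _ emeasure])
    also have "\<dots> = (\<integral>\<^sup>+z. indicator (cball 0 1) z * indicator {z. x < cmod z} z \<partial>lborel)"
      by (rule emeasure_density) measurable
    also have "\<dots> = (\<integral>\<^sup>+z. indicator (cball 0 1 \<inter> {z. x < cmod z}) z \<partial>lborel)"
      by (simp only: indicator_inter_arith)
    also have "\<dots> = emeasure lborel (cball (0::complex) 1 \<inter> {z. x < cmod z})"
      by (subst nn_integral_indicator) simp_all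
    finally show ?thesis .
  qed
  show "emeasure ?M {x<..} < \<infinity>"
  proof -
    have "emeasure ?M {x<..} \<le> emeasure lborel (cball (0::complex) 1)"
      unfolding M by (intro emeasure_mono) auto
    also have "\<dots> < \<infinity>" by (simp add: emeasure_cball)
    finally show ?thesis .
  qed
  have N: "emeasure ?N {x<..} = (\<integral>\<^sup>+r. ennreal (2 * pi * r) * indicator {max 0 x..1} r \<partial>lborel)"
  proof -
    have "emeasure ?N {x<..} =
        (\<integral>\<^sup>+r. ennreal (2 * pi * r) * indicator {0..1} r * indicator {x<..} r \<partial>lborel)"
      by (subst emeasure_density) auto
    also have "\<dots> = (\<integral>\<^sup>+r. ennreal (2 * pi * r) * indicator {max 0 x..1} r \<partial>lborel)"
    proof (rule nn_integral_cong_AE)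
      \<comment> \<open>The two indicators differ at most at \<open>r = x\<close>.\<close>
      show "AE r in lborel. ennreal (2 * pi * r) * indicator {0..1} r * indicator {x<..} r =
          ennreal (2 * pi * r) * indicator {max 0 x..1} r"
        using AE_lborel_singleton[of x] by eventually_elim (auto simp: indicator_def)
    qed
    finally show ?thesis .
  qed
  show "emeasure ?M {x<..} = emeasure ?N {x<..}"
  proof (cases "max 0 x \<le> 1")
    case False
    then have "x > 1" by auto
    then have "cball (0::complex) 1 \<inter> {z. x < cmod z} = {}" by auto
    moreover have "{max 0 x..1} = {}" using \<open>x > 1\<close> by auto
    ultimately show ?thesis unfolding M N by simp
  next
    case True
    have "(\<integral>\<^sup>+r. ennreal (2 * pi * r) * indicator {max 0 x..1} r \<partial>lborel) =
        ennreal (pi * 1\<^sup>2 - pi * (max 0 x)\<^sup>2)"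
      using True
      by (intro nn_integral_FTC_Icc) (auto intro!: derivative_eq_intros)
    moreover have "emeasure lborel (cball (0::complex) 1 \<inter> {z. x < cmod z}) =
        ennreal (pi * 1\<^sup>2 - pi * (max 0 x)\<^sup>2)"
    proof (cases "x < 0")
      case True
      then have "cball (0::complex) 1 \<inter> {z. x < cmod z} = cball 0 1"
        by (auto intro: less_le_trans)
      then show ?thesis using True by (simp add: emeasure_cball unit_ball_vol_2)
    next
      case x: False
      have "cball (0::complex) 1 \<inter> {z. x < cmod z} = cball 0 1 - cball 0 x" by auto
      also have "emeasure lborel \<dots> = emeasure lborel (cball (0::complex) 1) - emeasure lborel (cball (0::complex) x)"
        using x True by (intro emeasure_Diff) (auto simp: emeasure_cball)
      also have "\<dots> = ennreal (pi * 1\<^sup>2 - pi * (max 0 x)\<^sup>2)"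
        using x True by (simp add: emeasure_cball unit_ball_vol_2 ennreal_minus)
      finally show ?thesis .
    qed
    ultimately show ?thesis unfolding M N by simp
  qed
qed simp_all

lemma nn_integral_radial:
  assumes [measurable]: "h \<in> borel_measurable borel"
  shows "(\<integral>\<^sup>+z. h (cmod z) * indicator (cball 0 1) z \<partial>lborel) =
    (\<integral>\<^sup>+r. h r * (ennreal (2 * pi * r) * indicator {0..1} r) \<partial>lborel)"
proof -
  have "(\<integral>\<^sup>+z. h (cmod z) * indicator (cball 0 1) z \<partial>lborel) =
      (\<integral>\<^sup>+r. h r \<partial>distr (density lborel (indicator (cball (0::complex) 1))) borel cmod)"
    by (simp add: nn_integral_distr nn_integral_density mult.commute)
  also have "\<dots> = (\<integral>\<^sup>+r. h r * (ennreal (2 * pi * r) * indicator {0..1} r) \<partial>lborel)"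
    unfolding distr_cmod_disc by (simp add: nn_integral_density mult.commute)
  finally show ?thesis .
qed

text \<open>A null set of radii pulls back to a null set in the disc, since the law of the modulus
  has a density.\<close>

lemma AE_radial:
  assumes "AE r in lborel. P r"
  shows "AE z in lborel. cmod z \<le> 1 \<longrightarrow> P (cmod z)"
proof -
  obtain N where N: "{r. \<not> P r} \<subseteq> N" "N \<in> null_sets lborel"
    using assms by (auto simp: eventually_ae_filter)
  then have [measurable]: "N \<in> sets borel" by auto
  have "(\<integral>\<^sup>+z. indicator N (cmod z) * indicator (cball 0 1) z \<partial>lborel) =
      (\<integral>\<^sup>+r. indicator N r * (ennreal (2 * pi * r) * indicator {0..1} r) \<partial>lborel)"
    by (rule nn_integral_radial) auto
  also have "\<dots> = (\<integral>\<^sup>+r. 0 \<partial>(lborel :: real measure))"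
  proof (rule nn_integral_cong_AE)
    show "AE r in lborel. indicator N r * (ennreal (2 * pi * r) * indicator {0..1} r) = 0"
      using AE_not_in[OF N(2)] by eventually_elim simp
  qed
  finally have "(\<integral>\<^sup>+z. indicator N (cmod z) * indicator (cball 0 1) z \<partial>lborel) = 0"
    by simp
  then have "AE z in lborel. indicator N (cmod z) * indicator (cball 0 1) z = (0::ennreal)"
    by (subst (asm) nn_integral_0_iff_AE) measurable
  then show ?thesis
    by eventually_elim (use N(1) in \<open>auto simp: indicator_def split: if_splits\<close>)
qed

subsection \<open>Minimality of the energy\<close>

text \<open>\<open>A\<close>, \<open>B\<close> are the positive and negative parts of an integral,
  \<open>C\<close>, \<open>D\<close> those of a constant shift, and \<open>T\<close> is the integral
  of the shifted, nonnegative integrand. The balance equations avoid subtraction, so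
  \<open>A\<close> and \<open>A'\<close> may be infinite.\<close>

lemma ext_integral_diff_le:
  assumes "T \<le> T'" "C < \<infinity>" "D < \<infinity>" "B < \<infinity>" "B' < \<infinity>"
    and "T + C + B = A + D" "T' + C + B' = A' + D"
  shows "enn2ereal A - enn2ereal B \<le> enn2ereal A' - enn2ereal B'"
    and "- \<infinity> < enn2ereal A' - enn2ereal B'"
proof -
  obtain c d b b' where r: "C = ennreal c" "D = ennreal d" "B = ennreal b" "B' = ennreal b'"
     "0 \<le> c" "0 \<le> d" "0 \<le> b" "0 \<le> b'"
    using assms(2-5) by (metis ennreal_cases infinity_ennreal_def less_irrefl)
  show "- \<infinity> < enn2ereal A' - enn2ereal B'"
    using r by (cases A') (auto simp: enn2ereal_ennreal)
  show "enn2ereal A - enn2ereal B \<le> enn2ereal A' - enn2ereal B'"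
  proof (cases "T' = \<infinity>")
    case True
    then have "A' = \<infinity>" using assms(7) r by (cases A') (auto simp: top_unique simp flip: ennreal_plus)
    then show ?thesis using r by (auto simp: enn2ereal_ennreal)
  next
    case False
    then obtain t t' where t: "T = ennreal t" "T' = ennreal t'" "0 \<le> t" "0 \<le> t'"
      using assms(1) by (metis ennreal_cases infinity_ennreal_def top_unique)
    then obtain a a' where a: "A = ennreal a" "A' = ennreal a'" "0 \<le> a" "0 \<le> a'"
      using assms(6,7) r by (cases A; cases A') auto
    have "t \<le> t'" "t + c + b = a + d" "t' + c + b' = a' + d"
      using assms(1,6,7) r t a by (simp_all flip: ennreal_plus)
    then show ?thesis using r t a by (simp add: enn2ereal_ennreal)
  qed
qed

text \<open>The balance equation of \<open>ext_integral_diff_le\<close> before integration; sign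
  cases for \<open>p * u\<close> and \<open>p * m\<close> settle it.\<close>

lemma ennreal_shift_split:
  fixes p u m :: real
  assumes "0 \<le> p" "m \<le> u"
  shows "ennreal (p * (u - m)) + ennreal (p * m) + ennreal (- (p * u)) =
    ennreal (p * u) + ennreal (- (p * m))"
proof -
  have "p * m \<le> p * u" using assms by (intro mult_left_mono)
  then have *: "ennreal (x - y) + ennreal y + ennreal (- x) = ennreal x + ennreal (- y)"
    if "x = p * u" "y = p * m" for x y
    using that by (cases "0 \<le> y"; cases "0 \<le> x") (auto simp: ennreal_neg simp flip: ennreal_plus)
  show ?thesis using *[OF refl refl] by (simp add: right_diff_distrib)
qed

lemma borel_measurable_quot [measurable]: "quot n a b \<in> borel_measurable borel"
  unfolding quot_def by measurable

lemma nn_integral_circle_le: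
  fixes \<Theta> :: "real \<Rightarrow> real"
  assumes conv: "convex_on UNIV \<Theta>" and even: "\<And>x. \<Theta> (- x) = \<Theta> x" and nonneg: "\<And>x. 0 \<le> \<Theta> x"
    and n: "n \<ge> 1" and z: "0 < cmod z" "cmod z < 1" and adm: "admissible n a"
  shows "(\<integral>\<^sup>+t. ennreal (\<Theta> (cmod (quot n (roots_config n) (\<lambda>_. 0) (z * circ t)))) * indicator {0..1} t \<partial>lborel)
       \<le> (\<integral>\<^sup>+t. ennreal (\<Theta> (cmod (quot n a b (z * circ t)))) * indicator {0..1} t \<partial>lborel)"
proof -
  have cont: "continuous_on UNIV \<Theta>"
    using convex_on_continuous[OF open_UNIV conv] .
  have *: "(\<integral>\<^sup>+t. ennreal (\<Theta> (cmod (quot n a b (z * circ t)))) * indicator {0..1} t \<partial>lborel) =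
      ennreal (integral {0..1} (\<lambda>t. \<Theta> (cmod (quot n a b (z * circ t)))))"
    if "admissible n a" for a b
    by (intro nn_integral_has_integral_lebesgue' nonneg integrable_integral integrable_continuous_real
      continuous_on_compose2[OF cont continuous_on_norm[OF continuous_on_circle(3)[OF that z(2)]]]) auto
  show ?thesis
    unfolding *[OF adm] *[OF admissible_roots_config]
    by (intro ennreal_leI circle_mean_minimal conv even n z adm)
qed

text \<open>Rotational averaging pulls \<open>p (cmod z)\<close> out of the mean over each circle,
  so the means can be compared for each \<open>z\<close> separately. Where
  \<open>circle_mean_minimal\<close> is silent, \<open>p\<close> vanishes.\<close>

lemma weighted_integral_le:
  fixes \<Theta> :: "real \<Rightarrow> real" and p :: "real \<Rightarrow> real"
  assumes conv: "convex_on UNIV \<Theta>" and even: "\<And>x. \<Theta> (- x) = \<Theta> x" and nonneg: "\<And>x. 0 \<le> \<Theta> x"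
    and n: "n \<ge> 1" and adm: "admissible n a"
    and p [measurable]: "p \<in> borel_measurable borel" and p0: "\<And>r. 0 \<le> p r"
      "\<And>r. r \<notin> {0<..<1} \<Longrightarrow> p r = 0"
  shows "(\<integral>\<^sup>+z. ennreal (p (cmod z) * \<Theta> (cmod (quot n (roots_config n) (\<lambda>_. 0) z))) \<partial>lborel)
       \<le> (\<integral>\<^sup>+z. ennreal (p (cmod z) * \<Theta> (cmod (quot n a b z))) \<partial>lborel)"
proof -
  have [measurable]: "\<Theta> \<in> borel_measurable borel"
    by (rule borel_measurable_continuous_onI[OF convex_on_continuous[OF open_UNIV conv]])
  have *: "(\<integral>\<^sup>+z. ennreal (p (cmod z) * \<Theta> (cmod (quot n a b z))) \<partial>lborel) =
    (\<integral>\<^sup>+z. ennreal (p (cmod z)) *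
      (\<integral>\<^sup>+t. ennreal (\<Theta> (cmod (quot n a b (z * circ t)))) * indicator {0..1} t \<partial>lborel) \<partial>lborel)" for a b
  proof -
    have "(\<integral>\<^sup>+t. ennreal (p (cmod (z * circ t)) * \<Theta> (cmod (quot n a b (z * circ t)))) *
        indicator {0..1} t \<partial>lborel) = ennreal (p (cmod z)) *
      (\<integral>\<^sup>+t. ennreal (\<Theta> (cmod (quot n a b (z * circ t)))) * indicator {0..1} t \<partial>lborel)" for z
      by (subst nn_integral_cmult[symmetric])
        (auto simp: norm_mult ennreal_mult nonneg p0 mult.assoc)
    then show ?thesis
      by (subst nn_integral_rotation_average) auto
  qed
  show ?thesis
    unfolding *
  proof (rule nn_integral_mono)
    fix z :: complex
    show "ennreal (p (cmod z)) *
      (\<integral>\<^sup>+t. ennreal (\<Theta> (cmod (quot n (roots_config n) (\<lambda>_. 0) (z * circ t)))) * indicator {0..1} t \<partial>lborel)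
      \<le> ennreal (p (cmod z)) *
      (\<integral>\<^sup>+t. ennreal (\<Theta> (cmod (quot n a b (z * circ t)))) * indicator {0..1} t \<partial>lborel)"
    proof (cases "cmod z \<in> {0<..<1}")
      case True
      then show ?thesis
        by (intro mult_left_mono nn_integral_circle_le conv even nonneg n adm) auto
    qed (simp add: p0)
  qed
qed

text \<open>
  A Borel version of the radial weight: only \<open>\<rho>\<close> itself is merely Lebesgue measurable. Discarding
  the radii 0 and 1 avoids the poles of the quotient.
\<close>
lemma obtain_borel_weight:
  fixes \<rho> :: "real \<Rightarrow> real"
  assumes meas: "\<rho> \<in> borel_measurable (lebesgue_on {0..1})"
    and nonneg: "\<And>r. r \<in> {0..1} \<Longrightarrow> 0 \<le> \<rho> r"
    and fin: "(\<integral>\<^sup>+ r. ennreal (\<rho> r * r) \<partial>lebesgue_on {0..1}) < \<infinity>"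
  obtains p where "p \<in> borel_measurable borel" "\<And>r. 0 \<le> p r" "\<And>r. r \<notin> {0<..<1} \<Longrightarrow> p r = 0"
    "(\<integral>\<^sup>+z. ennreal (p (cmod (z :: complex))) \<partial>lborel) < \<infinity>"
    "\<And>u :: complex \<Rightarrow> real. (\<integral>\<^sup>+z. ennreal (\<rho> (cmod z) * u z) \<partial>lebesgue_on (cball 0 1)) =
       (\<integral>\<^sup>+z. ennreal (p (cmod z) * u z) \<partial>lborel)"
proof -
  have "(\<lambda>r. \<rho> r * indicator {0..1} r) \<in> borel_measurable lebesgue"
    using meas by (subst (asm) borel_measurable_restrict_space_iff) (auto simp: mult.commute)
  then obtain h where h [measurable]: "h \<in> borel_measurable borel"
    and h_eq: "AE r in lborel. \<rho> r * indicator {0..1} r = h r"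
    using completion_ex_borel_measurable_real[of _ "lborel :: real measure"] by auto
  \<comment> \<open>The function \<open>h\<close> agrees with the weight only almost everywhere; the
    truncation makes \<open>p\<close> nonnegative at every radius.\<close>
  define p where "p r = max 0 (h r) * indicator {0<..<1} r" for r
  have p [measurable]: "p \<in> borel_measurable borel"
    unfolding p_def by measurable
  have p_eq: "AE r in lborel. \<rho> r * indicator {0..1} r = p r"
    using h_eq AE_lborel_singleton[of 0] AE_lborel_singleton[of 1]
  proof eventually_elim
    case (elim r)
    then show ?case using nonneg[of r] by (auto simp: p_def indicator_def)
  qed
  have eq: "(\<integral>\<^sup>+z. ennreal (\<rho> (cmod z) * u z) \<partial>lebesgue_on (cball 0 1)) =
       (\<integral>\<^sup>+z. ennreal (p (cmod z) * u z) \<partial>lborel)" for u :: "complex \<Rightarrow> real"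
  proof -
    have "(\<integral>\<^sup>+z. ennreal (\<rho> (cmod z) * u z) \<partial>lebesgue_on (cball 0 1)) =
        (\<integral>\<^sup>+z. ennreal (\<rho> (cmod z) * u z) * indicator (cball 0 1) z \<partial>lborel)"
      by (subst nn_integral_restrict_space) (auto simp: nn_integral_completion)
    also have "\<dots> = (\<integral>\<^sup>+z. ennreal (p (cmod z) * u z) \<partial>lborel)"
    proof (rule nn_integral_cong_AE)
      show "AE z in lborel. ennreal (\<rho> (cmod z) * u z) * indicator (cball 0 1) z =
          ennreal (p (cmod z) * u z)"
        using AE_radial[OF p_eq]
        by eventually_elim (auto simp: indicator_def p_def)
    qed
    finally show ?thesis .
  qed
  have "(\<integral>\<^sup>+z. ennreal (p (cmod (z :: complex))) \<partial>lborel) =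
      (\<integral>\<^sup>+z. ennreal (p (cmod z)) * indicator (cball 0 1) (z :: complex) \<partial>lborel)"
    by (intro nn_integral_cong) (auto simp: indicator_def p_def)
  also have "\<dots> = (\<integral>\<^sup>+r. ennreal (p r) * (ennreal (2 * pi * r) * indicator {0..1} r) \<partial>lborel)"
    by (rule nn_integral_radial) measurable
  also have "\<dots> = (\<integral>\<^sup>+r. ennreal (2 * pi) * (ennreal (\<rho> r * r) * indicator {0..1} r) \<partial>lborel)"
  proof (rule nn_integral_cong_AE)
    show "AE r in lborel. ennreal (p r) * (ennreal (2 * pi * r) * indicator {0..1} r) =
        ennreal (2 * pi) * (ennreal (\<rho> r * r) * indicator {0..1} r)"
      using p_eq
    proof eventually_elim
      case (elim r)
      show ?case
      proof (cases "r \<in> {0..1}")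
        case True
        then have "p r = \<rho> r" using elim by simp
        then show ?thesis using True nonneg[OF True] by (simp add: mult_ac flip: ennreal_mult)
      qed auto
    qed
  qed
  \<comment> \<open>The constant is pulled out over the completed measure because the integrand is
    only Lebesgue measurable.\<close>
  also have "\<dots> = (\<integral>\<^sup>+r. ennreal (2 * pi) * (ennreal (\<rho> r * r) * indicator {0..1} r) \<partial>lebesgue)"
    by (simp only: nn_integral_completion)
  also have "\<dots> = ennreal (2 * pi) * (\<integral>\<^sup>+r. ennreal (\<rho> r * r) * indicator {0..1} r \<partial>lebesgue)"
  proof (rule nn_integral_cmult)
    have "(\<lambda>r. ennreal (\<rho> r * r)) \<in> borel_measurable (lebesgue_on {0..1})"
      by (intro measurable_compose[OF _ measurable_ennreal] borel_measurable_times meas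
          measurable_restrict_space1[OF measurable_completion]) simp
    then show "(\<lambda>r. ennreal (\<rho> r * r) * indicator {0..1} r) \<in> borel_measurable lebesgue"
      by (subst (asm) borel_measurable_restrict_space_iff_ennreal) auto
  qed
  also have "\<dots> = ennreal (2 * pi) * (\<integral>\<^sup>+r. ennreal (\<rho> r * r) \<partial>lebesgue_on {0..1})"
    by (subst nn_integral_restrict_space) auto
  also have "\<dots> < \<infinity>"
    using fin by (simp add: ennreal_mult_less_top)
  finally have "(\<integral>\<^sup>+z. ennreal (p (cmod (z :: complex))) \<partial>lborel) < \<infinity>" .
  moreover have "0 \<le> p r" "r \<notin> {0<..<1} \<Longrightarrow> p r = 0" for r
    by (auto simp: p_def)
  ultimately show thesis
    using that[OF p] eq by blast
qed

theorem theorem1: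
  fixes \<rho> \<Psi> :: "real \<Rightarrow> real" and n :: nat
  assumes "\<rho> \<in> borel_measurable (lebesgue_on {0..1})"
    and "\<And>r. r \<in> {0..1} \<Longrightarrow> 0 \<le> \<rho> r"
    and "(\<integral>\<^sup>+ r. ennreal (\<rho> r * r) \<partial>lebesgue_on {0..1}) < \<infinity>"
    and "convex_on UNIV \<Psi>"
    and "\<And>x. \<Psi> (- x) = \<Psi> x"
    and "1 \<le> n"
  shows "admissible n (roots_config n) \<and>
         (\<forall>a b. admissible n a \<longrightarrow>
            - \<infinity> < energy \<rho> \<Psi> n a b \<and>
            energy \<rho> \<Psi> n (roots_config n) (\<lambda>_. 0) \<le> energy \<rho> \<Psi> n a b)"
proof -
  obtain p where p [measurable]: "p \<in> borel_measurable borel"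
    and p0: "\<And>r. 0 \<le> p r" "\<And>r. r \<notin> {0<..<1} \<Longrightarrow> p r = 0"
    and p_fin: "(\<integral>\<^sup>+z. ennreal (p (cmod (z :: complex))) \<partial>lborel) < \<infinity>"
    and p_eq: "\<And>u :: complex \<Rightarrow> real. (\<integral>\<^sup>+z. ennreal (\<rho> (cmod z) * u z) \<partial>lebesgue_on (cball 0 1)) =
       (\<integral>\<^sup>+z. ennreal (p (cmod z) * u z) \<partial>lborel)"
    by (rule obtain_borel_weight[OF assms(1-3)]) (assumption, rule that)
  \<comment> \<open>The minimum of \<open>\<Psi>\<close>; subtracting it reduces the comparison to a
    nonnegative integrand.\<close>
  define m where "m = \<Psi> 0"
  define \<Theta> where "\<Theta> x = \<Psi> x - m" for x
  have \<Psi>_ge: "m \<le> \<Psi> x" for x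
    using even_convex_mono[OF assms(4,5), of 0 x] even_convex_mono[OF assms(4,5), of 0 "- x"]
      assms(5)[of x] by (cases "0 \<le> x") (simp_all add: m_def)
  have \<Theta>: "convex_on UNIV \<Theta>" "\<And>x. \<Theta> (- x) = \<Theta> x" "\<And>x. 0 \<le> \<Theta> x"
    using convex_on_diff[OF assms(4), of "\<lambda>_. m"] assms(5) \<Psi>_ge
    by (simp_all add: \<Theta>_def[abs_def] concave_on_const)
  have [measurable]: "\<Psi> \<in> borel_measurable borel"
    by (rule borel_measurable_continuous_onI[OF convex_on_continuous[OF open_UNIV assms(4)]])
  define A where "A a b = (\<integral>\<^sup>+z. ennreal (p (cmod z) * \<Psi> (cmod (quot n a b z))) \<partial>lborel)" for a b
  define B where "B a b = (\<integral>\<^sup>+z. ennreal (- (p (cmod z) * \<Psi> (cmod (quot n a b z)))) \<partial>lborel)" for a b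
  define T where "T a b = (\<integral>\<^sup>+z. ennreal (p (cmod z) * \<Theta> (cmod (quot n a b z))) \<partial>lborel)" for a b
  define C where "C = (\<integral>\<^sup>+z. ennreal (p (cmod (z :: complex)) * m) \<partial>lborel)"
  define D where "D = (\<integral>\<^sup>+z. ennreal (- (p (cmod (z :: complex)) * m)) \<partial>lborel)"
  have energy: "energy \<rho> \<Psi> n a b = enn2ereal (A a b) - enn2ereal (B a b)" for a b
    unfolding energy_def ext_integral_def A_def B_def quot_def[symmetric]
    using p_eq[of "\<lambda>z. \<Psi> (cmod (quot n a b z))"] p_eq[of "\<lambda>z. - \<Psi> (cmod (quot n a b z))"] by simp
  have fin: "(\<integral>\<^sup>+z. ennreal (p (cmod (z :: complex)) * c) \<partial>lborel) < \<infinity>" for c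
  proof -
    have "(\<integral>\<^sup>+z. ennreal (p (cmod (z :: complex)) * c) \<partial>lborel) =
        (\<integral>\<^sup>+z. ennreal (p (cmod (z :: complex))) \<partial>lborel) * ennreal c"
      by (subst nn_integral_multc[symmetric]) (auto simp: ennreal_mult'' ennreal_mult' p0)
    then show ?thesis using p_fin by (simp add: ennreal_mult_less_top)
  qed
  have CD: "C < \<infinity>" "D < \<infinity>"
    unfolding C_def D_def using fin[of m] fin[of "- m"] by simp_all
  \<comment> \<open>Since \<open>m \<le> \<Psi> x\<close>, the negative part is dominated by that of
    the integrable function \<open>p (cmod z) * m\<close>.\<close>
  have "B a b \<le> D" for a b
    unfolding B_def D_def
    by (intro nn_integral_mono ennreal_leI) (simp add: mult_left_mono \<Psi>_ge p0)
  then have B: "B a b < \<infinity>" for a b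
    using CD(2) by (rule le_less_trans)
  have split: "T a b + C + B a b = A a b + D" for a b
  proof -
    have "T a b + C + B a b = (\<integral>\<^sup>+z. ennreal (p (cmod z) * (\<Psi> (cmod (quot n a b z)) - m)) +
        ennreal (p (cmod z) * m) + ennreal (- (p (cmod z) * \<Psi> (cmod (quot n a b z)))) \<partial>lborel)"
      unfolding T_def C_def B_def \<Theta>_def by (simp add: nn_integral_add)
    also have "\<dots> = (\<integral>\<^sup>+z. ennreal (p (cmod z) * \<Psi> (cmod (quot n a b z))) +
        ennreal (- (p (cmod z) * m)) \<partial>lborel)"
      by (simp only: ennreal_shift_split[OF p0(1) \<Psi>_ge])
    also have "\<dots> = A a b + D"
      unfolding A_def D_def by (simp add: nn_integral_add)
    finally show ?thesis .
  qed
  show ?thesis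
  proof (intro conjI allI impI admissible_roots_config)
    fix a b assume adm: "admissible n a"
    have "T (roots_config n) (\<lambda>_. 0) \<le> T a b"
      unfolding T_def by (rule weighted_integral_le[OF \<Theta> assms(6) adm p p0])
    note * = ext_integral_diff_le[OF this CD B B split split]
    show "- \<infinity> < energy \<rho> \<Psi> n a b"
      "energy \<rho> \<Psi> n (roots_config n) (\<lambda>_. 0) \<le> energy \<rho> \<Psi> n a b"
      unfolding energy by (fact *)+
  qed
qed

end
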